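(* Let $m,n$ be positive integers with $m<n$, let $a_k>0$ for $k\in[n-m]$, and let $A=\operatorname{diag}(a_1,\ldots,a_{n-m},0,\ldots,0)\in\mathbb{R}^{n\times n}$. Let $B$ be a real symmetric $n\times n$ matrix partitioned as $$B=\begin{pmatrix}B_{11}&B_{21}^T\\ B_{21}&B_{22}\end{pmatrix},\qquad B_{11}\in\mathbb{R}^{(n-m)\times(n-m)},\ B_{21}\in\mathbb{R}^{m\times(n-m)},\ B_{22}\in\mathbb{R}^{m\times m},$$ and let $r=\operatorname{rank}B_{22}$. For $\gamma=(\gamma_1,\gamma_2)$ let $d_\gamma$ be the coefficient of $t^{\gamma_1}x^{\gamma_2}$ in $p_{A+tB}(x)=\det(xI-A-tB)$. Let $\tilde\mu\in\{1,\ldots,\min\{m-r,n-m\}\}$. Then $d_{\tilde\gamma}=0$ for $\tilde\gamma=(r,m-r)+\tilde\mu(2,-1)$ if and only if $\operatorname{rank}\begin{pmatrix}B_{21}&B_{22}\end{pmatrix}<r+\tilde\mu$. In this case, $d_\gamma=0$ for every $$\gamma=(r,m-r)+\mu(2,-1)+\nu(1,0),\qquad \mu=\tilde\mu,\ldots,\min\{m-r,n-m\},\quad \nu=0,1,\ldots,n-m-\mu.$$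
   Context: $[n]=\{1,\ldots,n\}$. *)

theory Defs
  imports "Jordan_Normal_Form.DL_Rank" "Jordan_Normal_Form.Char_Poly"
begin

text \<open>
  Bivariate polynomials in \<open>t\<close> and \<open>x\<close> are represented as \<open>real poly poly\<close>:
  the outer variable is \<open>x\<close>, and the coefficients are polynomials in \<open>t\<close>.
  Since \<^const>\<open>char_poly\<close> of \<open>M\<close> is the determinant of \<open>x I - M\<close>, the polynomial below is
  \<open>det (x I - A - t B)\<close>, with \<open>A + t B\<close> a matrix over \<open>\<real>[t]\<close>.
\<close>

definition pencil_poly :: "real mat \<Rightarrow> real mat \<Rightarrow> real poly poly" where
  "pencil_poly A B =
     char_poly (map_mat (\<lambda>c. [:c:]) A + [:0, 1:] \<cdot>\<^sub>m map_mat (\<lambda>c. [:c:]) B)"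

text \<open>The coefficient of \<open>t ^ \<gamma>\<^sub>1 * x ^ \<gamma>\<^sub>2\<close>.\<close>

definition pencil_coeff :: "real mat \<Rightarrow> real mat \<Rightarrow> nat \<times> nat \<Rightarrow> real" where
  "pencil_coeff A B \<gamma> = coeff (coeff (pencil_poly A B) (snd \<gamma>)) (fst \<gamma>)"

text \<open>
  The rank is taken from the locale \<^locale>\<open>vec_space\<close>, whose dimension parameter is the length of
  the columns, i.e. the number of rows of the matrix.
\<close>

definition mat_rank :: "real mat \<Rightarrow> nat" where
  "mat_rank M = vec_space.rank (dim_row M) M"

definition append_cols :: "'a::zero mat \<Rightarrow> 'a mat \<Rightarrow> 'a mat" where
  "append_cols C D = four_block_mat C D (0\<^sub>m 0 (dim_col C)) (0\<^sub>m 0 (dim_col D))"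

end

theory Submission
  imports Defs
begin

text \<open>
  Index the rows and columns by \<open>{0..<n}\<close>, call the indices below \<open>p = n - m\<close> upper and the others
  lower, and write \<open>B[U]\<close> for the principal minor of \<open>B\<close> on the index set \<open>U\<close>. Expanding
  \<open>det (x I - A - t B)\<close> along its diagonal part (\<open>pencil_coeff_expansion\<close>) shows that, up to the sign
  \<open>(-1) ^ (n - \<gamma>\<^sub>2)\<close>, the coefficient \<open>d\<^sub>\<gamma>\<close> is the sum of \<open>(\<Prod>i\<in>T. a i) * B[U]\<close> over all disjoint \<open>T\<close> and
  \<open>U\<close> with \<open>card U = \<gamma>\<^sub>1\<close> whose union leaves out \<open>\<gamma>\<^sub>2\<close> indices. Only sets \<open>T\<close> of upper indices count,
  since the other diagonal entries of \<open>A\<close> vanish.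

  For \<open>\<gamma> = (r, m - r) + \<mu> (2, -1) + \<nu> (1, 0)\<close> this leaves \<open>card T = p - \<mu> - \<nu>\<close>. Split
  \<open>U = K \<union> L\<close> into upper indices \<open>K\<close> and lower indices \<open>L\<close>: then \<open>card K \<le> \<mu> + \<nu>\<close>, hence
  \<open>card L \<ge> r + \<mu>\<close>. If the lower rows \<open>(B21 B22)\<close> have rank less than \<open>r + \<mu>\<close>, the rows in \<open>L\<close> are
  dependent and every summand vanishes. This is the final claim, and for \<open>\<nu> = 0\<close> one direction of the
  equivalence.

  Conversely let \<open>\<nu> = 0\<close> and let \<open>R\<close> index a basis of the columns of \<open>B22\<close>, so \<open>card R = r\<close>. If
  \<open>card K < \<mu>\<close>, the rows in \<open>L\<close> are still dependent inside \<open>U\<close>, because they live on the columns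
  \<open>K\<close> and on the columns of \<open>B22\<close>, and \<open>card K + r < card L\<close>. If \<open>card K = \<mu>\<close>, then
  \<open>card L = card (K \<union> R)\<close>, and the identity
  \<open>B[R] * B[K \<union> L] = (-1) ^ \<mu> * (det of the block of B with rows L and columns K \<union> R)\<^sup>2\<close>
  (\<open>idet_bordered_low_rank\<close>) holds. As \<open>B[R] \<noteq> 0\<close>, all surviving summands have one and the same sign, so
  nothing cancels: \<open>d\<^sub>\<gamma> \<noteq> 0\<close> as soon as one of the squared minors is nonzero. When \<open>(B21 B22)\<close> has rank at
  least \<open>r + \<mu>\<close>, extending \<open>R\<close> by \<open>\<mu>\<close> columns of \<open>B21\<close> to an independent set and choosing suitable
  rows \<open>L\<close> gives such a minor.
\<close>

section \<open>Linearly independent families of functions\<close>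

text \<open>
  The functions \<open>f i\<close> are compared on \<open>X\<close> only. Keeping the index sets of the rows and the columns
  explicit lets independence of any subset of the columns of a matrix, on any subset of its rows, be stated
  without forming submatrices; families with repeated members are dependent.
\<close>

definition indep_family :: "'i set \<Rightarrow> 'j set \<Rightarrow> ('i \<Rightarrow> 'j \<Rightarrow> 'a::field) \<Rightarrow> bool" where
  "indep_family I X f \<longleftrightarrow>
     (\<forall>c. (\<forall>x\<in>X. (\<Sum>i\<in>I. c i * f i x) = 0) \<longrightarrow> (\<forall>i\<in>I. c i = 0))"

lemma indep_familyD:
  assumes "indep_family I X f" and "\<And>x. x \<in> X \<Longrightarrow> (\<Sum>i\<in>I. c i * f i x) = 0" and "i \<in> I"
  shows "c i = 0"
  using assms unfolding indep_family_def by blast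

lemma indep_familyI:
  assumes "\<And>c i. (\<And>x. x \<in> X \<Longrightarrow> (\<Sum>i\<in>I. c i * f i x) = 0) \<Longrightarrow> i \<in> I \<Longrightarrow> c i = 0"
  shows "indep_family I X f"
  using assms unfolding indep_family_def by blast

lemma not_indep_familyE:
  assumes "\<not> indep_family I X f"
  obtains c i where "\<And>x. x \<in> X \<Longrightarrow> (\<Sum>i\<in>I. c i * f i x) = 0" and "i \<in> I" and "c i \<noteq> 0"
  using assms unfolding indep_family_def by blast

lemma indep_family_subset:
  assumes "indep_family I X f" and "J \<subseteq> I" and "finite I"
  shows "indep_family J X f"
proof (rule indep_familyI)
  fix c j assume c: "\<And>x. x \<in> X \<Longrightarrow> (\<Sum>i\<in>J. c i * f i x) = 0" and j: "j \<in> J"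
  have "(if j \<in> J then c j else 0) = 0"
  proof (rule indep_familyD[OF assms(1)])
    show "(\<Sum>i\<in>I. (if i \<in> J then c i else 0) * f i x) = 0" if "x \<in> X" for x
    proof -
      have "(\<Sum>i\<in>I. (if i \<in> J then c i else 0) * f i x) = (\<Sum>i\<in>J. c i * f i x)"
        by (rule sum.mono_neutral_cong_right) (use assms in auto)
      then show ?thesis using c[OF that] by simp
    qed
    show "j \<in> I" using j assms by auto
  qed
  then show "c j = 0" using j by simp
qed

text \<open>
  A dependence relation of the family is a kernel vector of the matrix of values, whatever enumerations
  of the two index sets are chosen.
\<close>

lemma indep_family_iff_det:
  fixes f :: "'i \<Rightarrow> 'j \<Rightarrow> 'a::field"
  assumes e: "bij_betw e {0..<k} I" and h: "bij_betw h {0..<k} X"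
  shows "indep_family I X f \<longleftrightarrow> det (mat k k (\<lambda>(a, b). f (e b) (h a))) \<noteq> 0"
proof -
  let ?N = "mat k k (\<lambda>(a, b). f (e b) (h a))"
  have N: "?N \<in> carrier_mat k k" by simp
  have mult: "(?N *\<^sub>v v) $ a = (\<Sum>i\<in>I. v $ inv_into {0..<k} e i * f i (h a))"
    if v: "v \<in> carrier_vec k" and a: "a < k" for v a
  proof -
    have "(\<Sum>i\<in>I. v $ inv_into {0..<k} e i * f i (h a)) =
        (\<Sum>b\<in>{0..<k}. v $ inv_into {0..<k} e (e b) * f (e b) (h a))"
      using sum.reindex_bij_betw[OF e, of "\<lambda>i. v $ inv_into {0..<k} e i * f i (h a)"] by simp
    also have "\<dots> = (\<Sum>b\<in>{0..<k}. v $ b * f (e b) (h a))"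
      by (rule sum.cong) (use e in \<open>auto simp: bij_betw_inv_into_left\<close>)
    finally show ?thesis using v a by (simp add: scalar_prod_def mult.commute)
  qed
  show ?thesis
  proof
    assume ind: "indep_family I X f"
    show "det ?N \<noteq> 0"
    proof
      assume "det ?N = 0"
      then obtain v where v: "v \<in> carrier_vec k" "v \<noteq> 0\<^sub>v k" "?N *\<^sub>v v = 0\<^sub>v k"
        using det_0_iff_vec_prod_zero_field[OF N] by auto
      have "v $ b = 0" if b: "b < k" for b
      proof -
        have "v $ inv_into {0..<k} e (e b) = 0"
        proof (rule indep_familyD[OF ind, where c = "\<lambda>i. v $ inv_into {0..<k} e i"])
          show "(\<Sum>i\<in>I. v $ inv_into {0..<k} e i * f i x) = 0" if x: "x \<in> X" for x
          proof -
            obtain a where a: "a < k" "x = h a"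
              using x bij_betw_imp_surj_on[OF h] by fastforce
            have "(?N *\<^sub>v v) $ a = 0" using v(3) a by simp
            then show ?thesis using mult[OF v(1) a(1)] a(2) by metis
          qed
          show "e b \<in> I" using e b by (auto simp: bij_betw_def)
        qed
        then show ?thesis using e b by (simp add: bij_betw_inv_into_left)
      qed
      then show False using v(1,2) by (metis carrier_vecD eq_vecI index_zero_vec(1,2))
    qed
  next
    assume d: "det ?N \<noteq> 0"
    show "indep_family I X f"
    proof (rule indep_familyI)
      fix c i assume c: "\<And>x. x \<in> X \<Longrightarrow> (\<Sum>i\<in>I. c i * f i x) = 0" and i: "i \<in> I"
      define v where "v = vec k (\<lambda>b. c (e b))"
      have v: "v \<in> carrier_vec k" by (simp add: v_def)
      have "?N *\<^sub>v v = 0\<^sub>v k"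
      proof (rule eq_vecI)
        fix a assume "a < dim_vec (0\<^sub>v k :: 'a vec)"
        then have a: "a < k" by simp
        have "(\<Sum>i\<in>I. v $ inv_into {0..<k} e i * f i (h a)) = (\<Sum>i\<in>I. c i * f i (h a))"
        proof (rule sum.cong[OF refl])
          fix i assume i: "i \<in> I"
          have "inv_into {0..<k} e i \<in> {0..<k}"
            using e i by (metis bij_betw_imp_surj_on inv_into_into)
          then show "v $ inv_into {0..<k} e i * f i (h a) = c i * f i (h a)"
            using e i by (simp add: v_def bij_betw_inv_into_right)
        qed
        also have "\<dots> = 0" using c[of "h a"] h a by (auto simp: bij_betw_def)
        finally show "(?N *\<^sub>v v) $ a = 0\<^sub>v k $ a" using mult[OF v a] a by simp
      qed simp
      then have "v = 0\<^sub>v k" using d v det_0_iff_vec_prod_zero_field[OF N] by blast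
      moreover obtain b where "b < k" "i = e b"
        using bij_betw_imp_surj_on[OF e] i by fastforce
      ultimately show "c i = 0" by (metis index_vec index_zero_vec(1) v_def)
    qed
  qed
qed

text \<open>
  Padding the values with zeros makes the family independent on as many points as it has members, while
  the square matrix of its values then has a zero row.
\<close>

lemma not_indep_family_if_card_less:
  fixes f :: "'i \<Rightarrow> 'j \<Rightarrow> 'a::field"
  assumes "finite I" and "finite X" and "card X < card I"
  shows "\<not> indep_family I X f"
proof
  assume ind: "indep_family I X f"
  define k where "k = card I"
  obtain e where e: "bij_betw e {0..<k} I" using ex_bij_betw_nat_finite[OF assms(1)] k_def by auto
  obtain h where h: "bij_betw h {0..<card X} X" using ex_bij_betw_nat_finite[OF assms(2)] by auto
  define g where "g i a = (if a < card X then f i (h a) else 0)" for i and a :: nat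
  have "indep_family I {0..<k} g"
  proof (rule indep_familyI)
    fix c i assume c: "\<And>x. x \<in> {0..<k} \<Longrightarrow> (\<Sum>i\<in>I. c i * g i x) = 0" and i: "i \<in> I"
    show "c i = 0"
    proof (rule indep_familyD[OF ind _ i])
      fix x assume "x \<in> X"
      then obtain a where a: "a < card X" "x = h a" using bij_betw_imp_surj_on[OF h] by fastforce
      then show "(\<Sum>i\<in>I. c i * f i x) = 0" using c[of a] assms(3) by (simp add: g_def k_def)
    qed
  qed
  then have "det (mat k k (\<lambda>(a, b). g (e b) a)) \<noteq> 0"
    using indep_family_iff_det[OF e, of "\<lambda>x. x" "{0..<k}" g] by (simp add: bij_betw_def)
  moreover have "det (mat k k (\<lambda>(a, b). g (e b) a)) = 0"
  proof -
    \<comment> \<open>The last row of this matrix is zero.\<close>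
    have "(\<Prod>i = 0..<k. mat k k (\<lambda>(a, b). g (e b) a) $$ (i, p i)) = 0" if "p permutes {0..<k}" for p
    proof (rule prod_zero)
      have "k - 1 < k" using assms(3) k_def by simp
      moreover from this have "p (k - 1) < k" using permutes_in_image[OF that, of "k - 1"] by simp
      moreover have "\<not> k - 1 < card X" using assms(3) k_def by simp
      ultimately show "\<exists>i\<in>{0..<k}. mat k k (\<lambda>(a, b). g (e b) a) $$ (i, p i) = 0"
        by (intro bexI[of _ "k - 1"]) (auto simp: g_def)
    qed simp
    then show ?thesis by (subst det_def'[of _ k]) (auto intro!: sum.neutral)
  qed
  ultimately show False by simp
qed

text \<open>
  A maximal independent subfamily spans, because adjoining any further member creates a dependence relation
  in which that member has a nonzero coefficient.
\<close>

lemma indep_family_extend_to_basis: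
  fixes f :: "'i \<Rightarrow> 'j \<Rightarrow> 'a::field"
  assumes "finite I" and "J0 \<subseteq> I" and "indep_family J0 X f"
  obtains J H where "J0 \<subseteq> J" and "J \<subseteq> I" and "indep_family J X f"
    and "\<And>i x. i \<in> I \<Longrightarrow> x \<in> X \<Longrightarrow> f i x = (\<Sum>j\<in>J. H i j * f j x)"
proof -
  define S where "S = {J. J0 \<subseteq> J \<and> J \<subseteq> I \<and> indep_family J X f}"
  have "finite S" using assms(1) by (auto simp: S_def intro: finite_subset[of _ "Pow I"])
  moreover have "J0 \<in> S" using assms by (simp add: S_def)
  ultimately obtain J where J: "J \<in> S" and max: "\<And>J'. J' \<in> S \<Longrightarrow> J \<subseteq> J' \<Longrightarrow> J' = J"
    using finite_has_maximal2[of S J0] by (metis)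
  have JI: "J \<subseteq> I" and ind: "indep_family J X f" and J0: "J0 \<subseteq> J" using J by (auto simp: S_def)
  have fin: "finite J" using JI assms(1) by (rule finite_subset)
  have "\<exists>h. \<forall>x\<in>X. f i x = (\<Sum>j\<in>J. h j * f j x)" if i: "i \<in> I" for i
  proof (cases "i \<in> J")
    case True
    have "f i x = (\<Sum>j\<in>J. (if j = i then 1 else 0) * f j x)" for x
      using True fin by (simp add: if_distrib[of "\<lambda>z. z * _"] cong: if_cong)
    then show ?thesis by (intro exI[of _ "\<lambda>j. if j = i then 1 else 0"]) blast
  next
    case False
    have "insert i J \<notin> S" using max[of "insert i J"] False by auto
    then have "\<not> indep_family (insert i J) X f" using J0 JI i by (auto simp: S_def)
    then obtain c i' where c: "\<And>x. x \<in> X \<Longrightarrow> (\<Sum>j\<in>insert i J. c j * f j x) = 0"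
      and i': "i' \<in> insert i J" "c i' \<noteq> 0" by (rule not_indep_familyE) auto
    have s: "c i * f i x + (\<Sum>j\<in>J. c j * f j x) = 0" if "x \<in> X" for x
      using c[OF that] False fin by simp
    have "c i \<noteq> 0"
    proof
      assume "c i = 0"
      moreover from this have "c j = 0" if "j \<in> J" for j
        using indep_familyD[OF ind _ that, of c] s by simp
      ultimately show False using i' by auto
    qed
    have "f i x = (\<Sum>j\<in>J. (- c j / c i) * f j x)" if x: "x \<in> X" for x
    proof -
      have "c i * f i x = - (\<Sum>j\<in>J. c j * f j x)"
        using s[OF x] by (simp add: eq_neg_iff_add_eq_0)
      then have "f i x = - (\<Sum>j\<in>J. c j * f j x) / c i"
        using \<open>c i \<noteq> 0\<close> by (metis nonzero_mult_div_cancel_left)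
      then show ?thesis by (simp add: sum_divide_distrib sum_negf)
    qed
    then show ?thesis by (intro exI[of _ "\<lambda>j. - c j / c i"]) blast
  qed
  then have "\<exists>H. \<forall>i\<in>I. \<forall>x\<in>X. f i x = (\<Sum>j\<in>J. H i j * f j x)" by (intro bchoice) blast
  then show thesis using that[OF J0 JI ind] by blast
qed

text \<open>
  This is the equality of row rank and column rank: a maximal set \<open>L\<close> of points at which the
  evaluations are independent determines the values at every other point, so the family stays independent
  on \<open>L\<close>, and then counting both ways gives the cardinality of \<open>L\<close>.
\<close>

lemma indep_family_select_points:
  fixes f :: "'i \<Rightarrow> 'j \<Rightarrow> 'a::field"
  assumes ind: "indep_family J X f" and "finite J" and "finite X"
  obtains L where "L \<subseteq> X" and "card L = card J" and "indep_family J L f"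
proof -
  have empty: "indep_family {} J (\<lambda>x j. f j x)" by (simp add: indep_family_def)
  obtain L H where L: "L \<subseteq> X" "indep_family L J (\<lambda>x j. f j x)"
    and H: "\<And>x j. x \<in> X \<Longrightarrow> j \<in> J \<Longrightarrow> f j x = (\<Sum>l\<in>L. H x l * f j l)"
    by (rule indep_family_extend_to_basis[OF assms(3) empty_subsetI empty]) (rule that)
  have "indep_family J L f"
  proof (rule indep_familyI)
    fix c i assume c: "\<And>x. x \<in> L \<Longrightarrow> (\<Sum>j\<in>J. c j * f j x) = 0" and i: "i \<in> J"
    show "c i = 0"
    proof (rule indep_familyD[OF ind _ i])
      fix x assume x: "x \<in> X"
      have "(\<Sum>j\<in>J. c j * f j x) = (\<Sum>j\<in>J. \<Sum>l\<in>L. H x l * (c j * f j l))"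
        by (rule sum.cong) (auto simp: H[OF x] sum_distrib_left ac_simps)
      also have "\<dots> = (\<Sum>l\<in>L. H x l * (\<Sum>j\<in>J. c j * f j l))"
        by (subst sum.swap) (simp add: sum_distrib_left)
      also have "\<dots> = 0" using c by simp
      finally show "(\<Sum>j\<in>J. c j * f j x) = 0" .
    qed
  qed
  moreover have "finite L" using L(1) assms(3) by (rule finite_subset)
  moreover from this have "\<not> card L < card J" "\<not> card J < card L"
    using not_indep_family_if_card_less[of L J "\<lambda>x j. f j x"]
      not_indep_family_if_card_less[of J L f] assms(2) L(2) \<open>indep_family J L f\<close> by blast+
  ultimately show thesis using that[OF L(1)] by simp
qed

section \<open>Determinants over index sets\<close>

text \<open>
  Principal minors as a function of the index set. Leibniz's formula over the permutations of the set itself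
  makes expansions into minors direct, since no enumeration of the set enters.
\<close>

definition idet :: "nat set \<Rightarrow> (nat \<Rightarrow> nat \<Rightarrow> 'a::comm_ring_1) \<Rightarrow> 'a" where
  "idet I f = (\<Sum>p | p permutes I. of_int (sign p) * (\<Prod>i\<in>I. f i (p i)))"

lemma bij_betw_map_permutation:
  assumes h: "bij_betw h A B"
  shows "bij_betw (map_permutation A h) {p. p permutes A} {p. p permutes B}"
proof -
  have inv: "bij_betw (inv_into A h) B A" by (rule bij_betw_inv_into[OF h])
  show ?thesis
  proof (rule bij_betw_byWitness[where f' = "map_permutation B (inv_into A h)"])
    show "\<forall>p\<in>{p. p permutes A}. map_permutation B (inv_into A h) (map_permutation A h p) = p"
      by (auto intro!: map_permutation_compose_inv[OF h] bij_betw_inv_into_left[OF h])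
    show "\<forall>q\<in>{p. p permutes B}. map_permutation A h (map_permutation B (inv_into A h) q) = q"
      by (auto intro!: map_permutation_compose_inv[OF inv] bij_betw_inv_into_right[OF h])
    show "map_permutation A h ` {p. p permutes A} \<subseteq> {p. p permutes B}"
      using map_permutation_permutes[OF h] by auto
    show "map_permutation B (inv_into A h) ` {p. p permutes B} \<subseteq> {p. p permutes A}"
      using map_permutation_permutes[OF inv] by auto
  qed
qed

lemma idet_eq_det:
  assumes h: "bij_betw h {0..<k} I"
  shows "idet I f = det (mat k k (\<lambda>(i, j). f (h i) (h j)))"
proof -
  let ?m = "map_permutation {0..<k} h"
  have inj: "inj_on h {0..<k}" using h by (rule bij_betw_imp_inj_on)
  have "idet I f = (\<Sum>p | p permutes {0..<k}. of_int (sign (?m p)) * (\<Prod>i\<in>I. f i (?m p i)))"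
    unfolding idet_def using sum.reindex_bij_betw[OF bij_betw_map_permutation[OF h],
      of "\<lambda>p. of_int (sign p) * (\<Prod>i\<in>I. f i (p i))"] by simp
  also have "\<dots> = (\<Sum>p | p permutes {0..<k}. of_int (sign p) *
      (\<Prod>i = 0..<k. mat k k (\<lambda>(i, j). f (h i) (h j)) $$ (i, p i)))"
  proof (rule sum.cong[OF refl])
    fix p assume "p \<in> {p. p permutes {0..<k}}"
    then have p: "p permutes {0..<k}" by simp
    have "(\<Prod>i\<in>I. f i (?m p i)) = (\<Prod>i = 0..<k. f (h i) (?m p (h i)))"
      using prod.reindex_bij_betw[OF h, of "\<lambda>i. f i (?m p i)"] by simp
    also have "\<dots> = (\<Prod>i = 0..<k. mat k k (\<lambda>(i, j). f (h i) (h j)) $$ (i, p i))"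
    proof (rule prod.cong[OF refl])
      fix i assume i: "i \<in> {0..<k}"
      then have "p i < k" using permutes_in_image[OF p, of i] by simp
      moreover have "?m p (h i) = h (p i)" using inj i by (rule map_permutation_apply)
      ultimately show "f (h i) (?m p (h i)) = mat k k (\<lambda>(i, j). f (h i) (h j)) $$ (i, p i)"
        using i by simp
    qed
    finally show "of_int (sign (?m p)) * (\<Prod>i\<in>I. f i (?m p i)) = of_int (sign p) *
      (\<Prod>i = 0..<k. mat k k (\<lambda>(i, j). f (h i) (h j)) $$ (i, p i))"
      using sign_map_permutation[OF inj p] by simp
  qed
  finally show ?thesis by (subst det_def'[of _ k]) auto
qed

lemma idet_eq_0_iff:
  fixes f :: "nat \<Rightarrow> nat \<Rightarrow> 'a::field"
  assumes "finite I"
  shows "idet I f = 0 \<longleftrightarrow> \<not> indep_family I I f"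
proof -
  obtain h where h: "bij_betw h {0..<card I} I" using ex_bij_betw_nat_finite[OF assms] by auto
  let ?M = "mat (card I) (card I) (\<lambda>(i, j). f (h i) (h j))"
  have "transpose_mat ?M = mat (card I) (card I) (\<lambda>(a, b). f (h b) (h a))"
    by (rule eq_matI) auto
  then have "det ?M = det (mat (card I) (card I) (\<lambda>(a, b). f (h b) (h a)))"
    using det_transpose[of ?M "card I"] by simp
  then show ?thesis
    unfolding idet_eq_det[OF h] indep_family_iff_det[OF h h] by simp
qed

lemma idet_scale:
  assumes "finite I"
  shows "idet I (\<lambda>i j. c * f i j) = c ^ card I * idet I f"
proof -
  have "of_int (sign p) * (\<Prod>i\<in>I. c * f i (p i)) = c ^ card I * (of_int (sign p) * (\<Prod>i\<in>I. f i (p i)))" for p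
    by (simp add: prod.distrib mult.left_commute)
  then show ?thesis unfolding idet_def sum_distrib_left by (intro sum.cong) auto
qed

lemma (in comm_ring_hom) hom_idet: "hom (idet I f) = idet I (\<lambda>i j. hom (f i j))"
  unfolding idet_def by (simp add: hom_sum hom_prod hom_mult hom_of_int)

text \<open>
  In Leibniz's formula every factor is a sum of a diagonal and a general part. Choosing the diagonal part
  on \<open>S\<close> forces the permutation to fix \<open>S\<close>, which leaves a permutation of the complement of \<open>S\<close> with the
  same sign.
\<close>

lemma idet_add_diagonal:
  fixes f :: "nat \<Rightarrow> nat \<Rightarrow> 'a::comm_ring_1"
  assumes fin: "finite I"
  shows "idet I (\<lambda>i j. (if i = j then d i else 0) + f i j) =
    (\<Sum>S\<in>Pow I. (\<Prod>i\<in>S. d i) * idet (I - S) f)"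
proof -
  have perms: "p permutes I \<and> (\<forall>i\<in>S. p i = i) \<longleftrightarrow> p permutes (I - S)" if "S \<subseteq> I" for p S
    using that by (auto simp: permutes_def)
  have finp: "finite {p. p permutes I}" by (rule finite_permutations[OF fin])
  have "idet I (\<lambda>i j. (if i = j then d i else 0) + f i j) =
    (\<Sum>p | p permutes I. \<Sum>S\<in>Pow I. of_int (sign p) *
      ((\<Prod>i\<in>S. if i = p i then d i else 0) * (\<Prod>i\<in>I - S. f i (p i))))"
    unfolding idet_def prod_add[OF fin] by (simp add: sum_distrib_left)
  also have "\<dots> = (\<Sum>S\<in>Pow I. \<Sum>p | p permutes I. of_int (sign p) *
      ((\<Prod>i\<in>S. if i = p i then d i else 0) * (\<Prod>i\<in>I - S. f i (p i))))"
    by (rule sum.swap)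
  also have "\<dots> = (\<Sum>S\<in>Pow I. (\<Prod>i\<in>S. d i) * idet (I - S) f)"
  proof (rule sum.cong[OF refl])
    fix S assume "S \<in> Pow I"
    then have S: "S \<subseteq> I" and finS: "finite S" using fin by (auto intro: finite_subset)
    have "(\<Sum>p | p permutes I. of_int (sign p) *
        ((\<Prod>i\<in>S. if i = p i then d i else 0) * (\<Prod>i\<in>I - S. f i (p i)))) =
      (\<Sum>p | p permutes (I - S). of_int (sign p) * ((\<Prod>i\<in>S. d i) * (\<Prod>i\<in>I - S. f i (p i))))"
    proof (rule sum.mono_neutral_cong_right[OF finp])
      show "{p. p permutes (I - S)} \<subseteq> {p. p permutes I}" using perms[OF S] by auto
      show "\<forall>p\<in>{p. p permutes I} - {p. p permutes (I - S)}. of_int (sign p) *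
        ((\<Prod>i\<in>S. if i = p i then d i else 0) * (\<Prod>i\<in>I - S. f i (p i))) = 0"
      proof
        fix p assume "p \<in> {p. p permutes I} - {p. p permutes (I - S)}"
        then obtain i where "i \<in> S" "p i \<noteq> i" using perms[OF S] by auto
        then have "\<exists>i\<in>S. (if i = p i then d i else 0) = 0" by (intro bexI[of _ i]) auto
        then have "(\<Prod>i\<in>S. if i = p i then d i else 0) = 0" using finS by (intro prod_zero) auto
        then show "of_int (sign p) *
          ((\<Prod>i\<in>S. if i = p i then d i else 0) * (\<Prod>i\<in>I - S. f i (p i))) = 0" by simp
      qed
      fix p assume "p \<in> {p. p permutes (I - S)}"
      then have "\<forall>i\<in>S. p i = i" using perms[OF S] by auto
      then have "(\<Prod>i\<in>S. if i = p i then d i else 0) = (\<Prod>i\<in>S. d i)" by (intro prod.cong) auto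
      then show "of_int (sign p) * ((\<Prod>i\<in>S. if i = p i then d i else 0) * (\<Prod>i\<in>I - S. f i (p i))) =
        of_int (sign p) * ((\<Prod>i\<in>S. d i) * (\<Prod>i\<in>I - S. f i (p i)))" by simp
    qed
    also have "\<dots> = (\<Prod>i\<in>S. d i) * idet (I - S) f"
      unfolding idet_def by (simp add: sum_distrib_left ac_simps)
    finally show "(\<Sum>p | p permutes I. of_int (sign p) *
        ((\<Prod>i\<in>S. if i = p i then d i else 0) * (\<Prod>i\<in>I - S. f i (p i)))) =
      (\<Prod>i\<in>S. d i) * idet (I - S) f" .
  qed
  finally show ?thesis .
qed

text \<open>
  Inside \<open>U\<close>, the rows in \<open>L\<close> factor through a space of dimension \<open>card Z\<close>, so they are dependent.
\<close>

lemma idet_eq_0_if_rows_factor: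
  fixes f :: "nat \<Rightarrow> nat \<Rightarrow> 'a::field"
  assumes "finite U" and LU: "L \<subseteq> U" and "finite Z" and "card Z < card L"
    and factor: "\<And>j. j \<in> U \<Longrightarrow> \<exists>h. \<forall>x\<in>L. f x j = (\<Sum>k\<in>Z. h k * g k x)"
  shows "idet U f = 0"
proof -
  have finL: "finite L" using LU \<open>finite U\<close> by (rule finite_subset)
  have "\<not> indep_family L Z (\<lambda>x k. g k x)"
    by (rule not_indep_family_if_card_less) (use assms finL in auto)
  then obtain c l where c: "\<And>k. k \<in> Z \<Longrightarrow> (\<Sum>x\<in>L. c x * g k x) = 0" and l: "l \<in> L" "c l \<noteq> 0"
    by (rule not_indep_familyE) auto
  have "(\<Sum>i\<in>U. (if i \<in> L then c i else 0) * f i j) = 0" if j: "j \<in> U" for j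
  proof -
    obtain h where h: "\<And>x. x \<in> L \<Longrightarrow> f x j = (\<Sum>k\<in>Z. h k * g k x)" using factor[OF j] by auto
    have "(\<Sum>i\<in>U. (if i \<in> L then c i else 0) * f i j) = (\<Sum>x\<in>L. c x * f x j)"
      by (rule sum.mono_neutral_cong_right) (use assms in auto)
    also have "\<dots> = (\<Sum>x\<in>L. \<Sum>k\<in>Z. h k * (c x * g k x))"
      by (rule sum.cong) (auto simp: h sum_distrib_left mult.left_commute)
    also have "\<dots> = (\<Sum>k\<in>Z. h k * (\<Sum>x\<in>L. c x * g k x))"
      by (subst sum.swap) (simp add: sum_distrib_left)
    also have "\<dots> = 0" using c by simp
    finally show ?thesis .
  qed
  then have "\<not> indep_family U U f"
    using indep_familyD[of U U f "\<lambda>i. if i \<in> L then c i else 0" l] l LU by auto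
  then show ?thesis using idet_eq_0_iff[OF \<open>finite U\<close>] by blast
qed

lemma bij_betw_append:
  fixes m n :: nat
  assumes "bij_betw f {0..<m} A" and "bij_betw g {0..<n} B" and "A \<inter> B = {}"
  shows "bij_betw (\<lambda>i. if i < m then f i else g (i - m)) {0..<m + n} (A \<union> B)"
proof -
  let ?h = "\<lambda>i. if i < m then f i else g (i - m)"
  have "bij_betw ?h {0..<m} A"
    using assms(1) by (subst bij_betw_cong[of _ _ f]) auto
  moreover have "bij_betw ?h {m..<m + n} B"
  proof -
    have "bij_betw (\<lambda>i. i - m) {m..<m + n} {0..<n}"
      by (rule bij_betw_byWitness[where f' = "\<lambda>i. i + m"]) auto
    then have "bij_betw (g \<circ> (\<lambda>i. i - m)) {m..<m + n} B"
      using assms(2) by (rule bij_betw_trans)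
    then show ?thesis by (subst bij_betw_cong[of _ _ "g \<circ> (\<lambda>i. i - m)"]) auto
  qed
  ultimately have "bij_betw ?h ({0..<m} \<union> {m..<m + n}) (A \<union> B)"
    using assms(3) by (rule bij_betw_combine)
  moreover have "{0..<m} \<union> {m..<m + n} = {0..<m + n}" by auto
  ultimately show ?thesis by simp
qed

lemma sum_append:
  fixes g :: "nat \<Rightarrow> 'a::comm_monoid_add"
  shows "sum g {0..<m + n} = sum g {0..<m} + (\<Sum>i\<in>{0..<n}. g (m + i))"
  by (induction n) (auto simp: add.assoc)

text \<open>
  After regrouping the blocks, the matrix is block diagonal with blocks \<open>(X 1; 1 0)\<close> and \<open>S\<close>.
\<close>

lemma det_bordered_identity:
  fixes X S :: "'a::idom mat"
  assumes X: "X \<in> carrier_mat k k" and S: "S \<in> carrier_mat r r"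
  defines "E \<equiv> mat k (k + r) (\<lambda>(i, j). if i = j then 1 else 0)"
  shows "det (four_block_mat X E (transpose_mat E)
    (four_block_mat (0\<^sub>m k k) (0\<^sub>m k r) (0\<^sub>m r k) S)) = (- 1) ^ k * det S"
proof -
  let ?N1 = "four_block_mat X (1\<^sub>m k) (1\<^sub>m k) (0\<^sub>m k k)"
  have N1: "?N1 \<in> carrier_mat (k + k) (k + k)" using X by auto
  have "four_block_mat X E (transpose_mat E)
      (four_block_mat (0\<^sub>m k k) (0\<^sub>m k r) (0\<^sub>m r k) S) =
    four_block_mat ?N1 (0\<^sub>m (k + k) r) (0\<^sub>m r (k + k)) S"
    using X S by (intro eq_matI) (auto simp: E_def)
  moreover have "det \<dots> = det ?N1 * det S"
    by (rule det_four_block_mat_upper_right_zero[OF N1 _ _ S]) auto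
  moreover have "det ?N1 = (- 1) ^ k"
  proof -
    have "det ?N1 = det (X * 0\<^sub>m k k - 1\<^sub>m k * 1\<^sub>m k)"
      by (rule det_four_block_mat[OF X]) auto
    also have "X * 0\<^sub>m k k - 1\<^sub>m k * 1\<^sub>m k = (- 1) \<cdot>\<^sub>m 1\<^sub>m k"
      using X by (intro eq_matI) auto
    finally show ?thesis by simp
  qed
  ultimately show ?thesis by simp
qed

text \<open>
  With \<open>Y\<close> the block of \<open>f\<close> with rows \<open>L\<close> and columns \<open>K\<close>, with \<open>S\<close> the block on \<open>R\<close>, and with
  \<open>H\<close> restricted to \<open>L\<close> and \<open>R\<close>, symmetry turns the hypothesis on \<open>H\<close> into \<open>f = H S H\<^sup>T\<close> on \<open>L\<close>.
  So the matrix \<open>(X Y\<^sup>T; Y H S H\<^sup>T)\<close> of \<open>f\<close> on \<open>K \<union> L\<close> is \<open>P N P\<^sup>T\<close>, where \<open>P\<close> is block diagonal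
  with blocks \<open>1\<close> and \<open>W = (Y H)\<close>, and \<open>N\<close> is the matrix of the preceding lemma. The count
  \<open>card L = card K + card R\<close> is what makes \<open>W\<close> square, which gives
  \<open>(det W)\<^sup>2 * (-1) ^ card K * det S\<close> for the minor on \<open>K \<union> L\<close>. Multiplying by \<open>det S\<close> replaces \<open>H\<close> by
  \<open>H S\<close>, the block of \<open>f\<close> with rows \<open>L\<close> and columns \<open>R\<close>, so that \<open>\<delta>\<close> is the minor of \<open>f\<close> with
  rows \<open>L\<close> and columns \<open>K \<union> R\<close>.
\<close>

lemma idet_bordered_low_rank:
  fixes f :: "nat \<Rightarrow> nat \<Rightarrow> 'a::field"
  assumes fin: "finite K" "finite L" "finite R"
    and disj: "K \<inter> L = {}" "K \<inter> R = {}" and card: "card L = card K + card R"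
    and sym: "\<And>x y. f x y = f y x"
    and H: "\<And>x y. x \<in> L \<Longrightarrow> y \<in> L \<union> R \<Longrightarrow> f x y = (\<Sum>a\<in>R. H x a * f a y)"
  obtains \<delta> where "idet R f * idet (K \<union> L) f = (- 1) ^ card K * \<delta>\<^sup>2"
    and "indep_family (K \<union> R) L f \<longleftrightarrow> \<delta> \<noteq> 0"
proof -
  define k r where "k = card K" and "r = card R"
  obtain u where u: "bij_betw u {0..<k} K" using ex_bij_betw_nat_finite[OF fin(1)] k_def by auto
  obtain v where v: "bij_betw v {0..<r} R" using ex_bij_betw_nat_finite[OF fin(3)] r_def by auto
  obtain w where w: "bij_betw w {0..<k + r} L"
    using ex_bij_betw_nat_finite[OF fin(2)] card k_def r_def by auto
  have uK: "u i \<in> K" if "i < k" for i using u that by (auto simp: bij_betw_def)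
  have vR: "v i \<in> R" if "i < r" for i using v that by (auto simp: bij_betw_def)
  have wL: "w i \<in> L" if "i < k + r" for i using w that by (auto simp: bij_betw_def)
  have H': "(\<Sum>l\<in>{0..<r}. H (w i) (v l) * f (v l) y) = f (w i) y" if "i < k + r" "y \<in> L \<union> R" for i y
    using sum.reindex_bij_betw[OF v, of "\<lambda>a. H (w i) a * f a y"] H[OF wL] that by simp
  define h where "h = (\<lambda>i. if i < k then u i else w (i - k))"
  define e where "e = (\<lambda>i. if i < k then u i else v (i - k))"
  have h: "bij_betw h {0..<k + (k + r)} (K \<union> L)"
    unfolding h_def by (rule bij_betw_append[OF u w disj(1)])
  have e: "bij_betw e {0..<k + r} (K \<union> R)"
    unfolding e_def by (rule bij_betw_append[OF u v disj(2)])
  define X where "X = mat k k (\<lambda>(i, j). f (u i) (u j))"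
  define Y where "Y = mat (k + r) k (\<lambda>(i, j). f (w i) (u j))"
  define Z where "Z = mat (k + r) (k + r) (\<lambda>(i, j). f (w i) (w j))"
  define S where "S = mat r r (\<lambda>(i, j). f (v i) (v j))"
  define V where "V = mat (k + r) (k + r) (\<lambda>(i, j). f (e j) (w i))"
  define W where "W = mat (k + r) (k + r) (\<lambda>(i, j). if j < k then f (w i) (u j) else H (w i) (v (j - k)))"
  define E where "E = mat k (k + r) (\<lambda>(i, j). if i = j then (1::'a) else 0)"
  define D where "D = four_block_mat (0\<^sub>m k k) (0\<^sub>m k r) (0\<^sub>m r k) S"
  define P where "P = four_block_mat (1\<^sub>m k) (0\<^sub>m k (k + r)) (0\<^sub>m (k + r) k) W"
  define N where "N = four_block_mat X E (transpose_mat E) D"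
  define Q where "Q = four_block_mat (1\<^sub>m k) (0\<^sub>m k r) (0\<^sub>m r k) S"
  have carr: "X \<in> carrier_mat k k" "Y \<in> carrier_mat (k + r) k" "Z \<in> carrier_mat (k + r) (k + r)"
    "S \<in> carrier_mat r r" "V \<in> carrier_mat (k + r) (k + r)" "W \<in> carrier_mat (k + r) (k + r)"
    "E \<in> carrier_mat k (k + r)" "D \<in> carrier_mat (k + r) (k + r)"
    "P \<in> carrier_mat (k + (k + r)) (k + (k + r))" "N \<in> carrier_mat (k + (k + r)) (k + (k + r))"
    "Q \<in> carrier_mat (k + r) (k + r)"
    by (auto simp: X_def Y_def Z_def S_def V_def W_def E_def D_def P_def N_def Q_def)
  have WE: "W * transpose_mat E = Y"
  proof (rule eq_matI)
    fix i j assume "i < dim_row Y" "j < dim_col Y"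
    then have ij: "i < k + r" "j < k" using carr by auto
    have "(W * transpose_mat E) $$ (i, j) = (\<Sum>l\<in>{0..<k + r}. W $$ (i, l) * (if j = l then 1 else 0))"
      using ij carr by (simp add: scalar_prod_def E_def)
    also have "\<dots> = W $$ (i, j)" using ij by (simp add: if_distrib cong: if_cong)
    finally show "(W * transpose_mat E) $$ (i, j) = Y $$ (i, j)" using ij by (simp add: W_def Y_def)
  qed (use carr in auto)
  have EW: "E * transpose_mat W = transpose_mat Y"
    using transpose_mult[of W "k + r" "k + r" "transpose_mat E" k] WE carr by simp
  have WD: "W * D = mat (k + r) (k + r) (\<lambda>(i, j). if j < k then 0 else f (w i) (v (j - k)))"
  proof (rule eq_matI)
    fix i j assume "i < dim_row (mat (k + r) (k + r) (\<lambda>(i, j). if j < k then 0 else f (w i) (v (j - k))))"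
      "j < dim_col (mat (k + r) (k + r) (\<lambda>(i, j). if j < k then 0 else f (w i) (v (j - k))))"
    then have ij: "i < k + r" "j < k + r" by auto
    have "(W * D) $$ (i, j) = (\<Sum>l\<in>{0..<k + r}. W $$ (i, l) * D $$ (l, j))"
      using ij carr by (simp add: scalar_prod_def)
    also have "\<dots> = (\<Sum>l\<in>{0..<r}. W $$ (i, k + l) * D $$ (k + l, j))"
    proof -
      have "(\<Sum>l\<in>{0..<k}. W $$ (i, l) * D $$ (l, j)) = 0"
        using ij carr(4) by (intro sum.neutral) (auto simp: D_def)
      then show ?thesis unfolding sum_append by simp
    qed
    also have "\<dots> = (\<Sum>l\<in>{0..<r}. H (w i) (v l) * (if j < k then 0 else f (v l) (v (j - k))))"
      using ij by (intro sum.cong) (auto simp: W_def D_def S_def)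
    also have "\<dots> = (if j < k then 0 else f (w i) (v (j - k)))"
      using ij H'[OF ij(1), of "v (j - k)"] vR[of "j - k"] by simp
    finally show "(W * D) $$ (i, j) =
        mat (k + r) (k + r) (\<lambda>(i, j). if j < k then 0 else f (w i) (v (j - k))) $$ (i, j)"
      using ij by simp
  qed (use carr in auto)
  have WDW: "W * D * transpose_mat W = Z"
  proof (rule eq_matI)
    fix i j assume "i < dim_row Z" "j < dim_col Z"
    then have ij: "i < k + r" "j < k + r" using carr by auto
    have "(W * D * transpose_mat W) $$ (i, j) = (\<Sum>l\<in>{0..<k + r}. (W * D) $$ (i, l) * W $$ (j, l))"
      unfolding WD using ij carr by (simp add: scalar_prod_def)
    also have "\<dots> = (\<Sum>l\<in>{0..<r}. f (w i) (v l) * H (w j) (v l))"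
      unfolding sum_append WD using ij by (simp add: W_def)
    also have "\<dots> = (\<Sum>l\<in>{0..<r}. H (w j) (v l) * f (v l) (w i))"
      by (intro sum.cong) (auto simp: mult.commute sym)
    also have "\<dots> = f (w i) (w j)" using H'[OF ij(2), of "w i"] wL[OF ij(1)] sym by simp
    finally show "(W * D * transpose_mat W) $$ (i, j) = Z $$ (i, j)" using ij by (simp add: Z_def)
  qed (use carr in auto)
  have WQ: "W * Q = V"
  proof (rule eq_matI)
    fix i j assume "i < dim_row V" "j < dim_col V"
    then have ij: "i < k + r" "j < k + r" using carr by auto
    have "(W * Q) $$ (i, j) = (\<Sum>l\<in>{0..<k + r}. W $$ (i, l) * Q $$ (l, j))"
      using ij carr by (simp add: scalar_prod_def)
    also have "\<dots> = (\<Sum>l\<in>{0..<k}. W $$ (i, l) * Q $$ (l, j)) +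
        (\<Sum>l\<in>{0..<r}. W $$ (i, k + l) * Q $$ (k + l, j))"
      by (rule sum_append)
    also have "(\<Sum>l\<in>{0..<k}. W $$ (i, l) * Q $$ (l, j)) =
        (\<Sum>l\<in>{0..<k}. if j = l then f (w i) (u l) else 0)"
      using ij carr(4) by (intro sum.cong) (auto simp: W_def Q_def)
    also have "\<dots> = (if j < k then f (w i) (u j) else 0)" by simp
    also have "(\<Sum>l\<in>{0..<r}. W $$ (i, k + l) * Q $$ (k + l, j)) =
        (\<Sum>l\<in>{0..<r}. H (w i) (v l) * (if j < k then 0 else f (v l) (v (j - k))))"
      using ij by (intro sum.cong) (auto simp: W_def Q_def S_def)
    also have "\<dots> = (if j < k then 0 else f (w i) (v (j - k)))"
      using ij H'[OF ij(1), of "v (j - k)"] vR[of "j - k"] by simp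
    finally show "(W * Q) $$ (i, j) = V $$ (i, j)" using ij sym by (simp add: V_def e_def)
  qed (use carr in auto)
  have M: "mat (k + (k + r)) (k + (k + r)) (\<lambda>(i, j). f (h i) (h j)) = P * N * transpose_mat P"
  proof -
    have "P * N = four_block_mat X E Y (W * D)"
      unfolding P_def N_def
      by (subst mult_four_block_mat[where ?nr1.0 = k and ?n1.0 = k and ?n2.0 = "k + r"
            and ?nr2.0 = "k + r" and ?nc1.0 = k and ?nc2.0 = "k + r"])
        (use carr WE in \<open>auto\<close>)
    moreover have "transpose_mat P = four_block_mat (1\<^sub>m k) (0\<^sub>m k (k + r)) (0\<^sub>m (k + r) k) (transpose_mat W)"
      unfolding P_def
      by (subst transpose_four_block_mat[where ?nr1.0 = k and ?nc1.0 = k and ?nr2.0 = "k + r"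
            and ?nc2.0 = "k + r"]) (use carr in auto)
    moreover have "four_block_mat X E Y (W * D) *
        four_block_mat (1\<^sub>m k) (0\<^sub>m k (k + r)) (0\<^sub>m (k + r) k) (transpose_mat W) =
      four_block_mat X (transpose_mat Y) Y Z"
      by (subst mult_four_block_mat[where ?nr1.0 = k and ?n1.0 = k and ?n2.0 = "k + r"
            and ?nr2.0 = "k + r" and ?nc1.0 = k and ?nc2.0 = "k + r"])
        (use carr EW WDW in \<open>auto\<close>)
    moreover have "mat (k + (k + r)) (k + (k + r)) (\<lambda>(i, j). f (h i) (h j)) =
        four_block_mat X (transpose_mat Y) Y Z"
      by (rule eq_matI) (auto simp: X_def Y_def Z_def h_def sym)
    ultimately show ?thesis by simp
  qed
  have detP: "det P = det W"
    unfolding P_def using carr by (subst det_four_block_mat_upper_right_zero[of _ k _ "k + r"]) auto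
  have detQ: "det Q = det S"
    unfolding Q_def using carr by (subst det_four_block_mat_upper_right_zero[of _ k _ r]) auto
  have detN: "det N = (- 1) ^ k * det S"
    unfolding N_def D_def E_def by (rule det_bordered_identity[OF carr(1,4)])
  have "idet (K \<union> L) f = det W * ((- 1) ^ k * det S) * det W"
    unfolding idet_eq_det[OF h] M using carr detP detN
    by (simp add: det_mult[of _ "k + (k + r)"] det_transpose[of _ "k + (k + r)"])
  moreover have "idet R f = det S" unfolding idet_eq_det[OF v] S_def ..
  moreover have "det V = det W * det S"
    unfolding WQ[symmetric] using det_mult[OF carr(6,11)] detQ by simp
  ultimately have "idet R f * idet (K \<union> L) f = (- 1) ^ card K * (det V)\<^sup>2"
    by (simp add: k_def power2_eq_square)
  moreover have "indep_family (K \<union> R) L f \<longleftrightarrow> det V \<noteq> 0"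
    unfolding V_def by (rule indep_family_iff_det[OF e w])
  ultimately show thesis by (rule that)
qed

section \<open>Matrix rank in terms of families\<close>

context vec_space
begin

text \<open>
  The injectivity clause is needed because a set of vectors forgets repetitions in the family.
\<close>

lemma indep_family_iff_lin_indpt:
  fixes f :: "'i \<Rightarrow> 'j \<Rightarrow> 'a"
  assumes u: "bij_betw u {0..<n} X" and fin: "finite I"
  defines "v \<equiv> \<lambda>i. vec n (\<lambda>k. f i (u k))"
  shows "indep_family I X f \<longleftrightarrow> inj_on v I \<and> lin_indpt (v ` I)"
proof -
  have carr: "v ` J \<subseteq> carrier_vec n" for J by (auto simp: v_def)
  have lc: "lincomb a (v ` I) $ k = (\<Sum>i\<in>I. a (v i) * f i (u k))"
    if "inj_on v I" "k < n" for a k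
    using that carr[of I] by (simp add: lincomb_index sum.reindex) (simp add: v_def)
  have surj: "\<exists>k<n. x = u k" if "x \<in> X" for x
    using that bij_betw_imp_surj_on[OF u] by fastforce
  show ?thesis
  proof (intro iffI conjI)
    assume ind: "indep_family I X f"
    show inj: "inj_on v I"
    proof (rule inj_onI, rule ccontr)
      fix i j assume ij: "i \<in> I" "j \<in> I" "v i = v j" "i \<noteq> j"
      have eq: "f i x = f j x" if x: "x \<in> X" for x
      proof -
        obtain k where "k < n" "x = u k" using surj[OF x] by auto
        then show ?thesis using arg_cong[OF ij(3), of "\<lambda>w. w $ k"] by (simp add: v_def)
      qed
      have "(\<Sum>l\<in>I. (if l = i then 1 else if l = j then - 1 else 0) * f l x) = 0" if x: "x \<in> X" for x
      proof -
        have "(\<Sum>l\<in>I. (if l = i then 1 else if l = j then - 1 else 0) * f l x) =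
          (\<Sum>l\<in>{i, j}. (if l = i then 1 else if l = j then - 1 else 0) * f l x)"
          by (rule sum.mono_neutral_right) (use ij fin in auto)
        also have "\<dots> = 0" using ij(4) eq[OF x] by simp
        finally show ?thesis .
      qed
      from indep_familyD[OF ind this ij(1)] show False by simp
    qed
    show "lin_indpt (v ` I)"
    proof (rule finite_lin_indpt2)
      show "finite (v ` I)" using fin by simp
      show "v ` I \<subseteq> carrier_vec n" by (rule carr)
      fix a assume zero: "lincomb a (v ` I) = 0\<^sub>v n"
      have "a (v i) = 0" if i: "i \<in> I" for i
      proof (rule indep_familyD[OF ind _ i, of "\<lambda>i. a (v i)"])
        fix x assume "x \<in> X"
        then obtain k where "k < n" "x = u k" using surj by auto
        then show "(\<Sum>i\<in>I. a (v i) * f i x) = 0"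
          using lc[OF inj, of k a] zero by simp
      qed
      then show "\<forall>w\<in>v ` I. a w = 0" by auto
    qed
  next
    assume R: "inj_on v I \<and> lin_indpt (v ` I)"
    show "indep_family I X f"
    proof (rule indep_familyI)
      fix c i assume c: "\<And>x. x \<in> X \<Longrightarrow> (\<Sum>i\<in>I. c i * f i x) = 0" and i: "i \<in> I"
      define a where "a = (\<lambda>w. c (inv_into I v w))"
      have av: "a (v i) = c i" if "i \<in> I" for i using R that by (simp add: a_def)
      have "lincomb a (v ` I) = 0\<^sub>v n"
      proof (rule eq_vecI)
        fix k assume "k < dim_vec (0\<^sub>v n :: 'a vec)"
        then have k: "k < n" by simp
        have "lincomb a (v ` I) $ k = (\<Sum>i\<in>I. c i * f i (u k))"
          using lc[of k a] R k av by (metis (mono_tags, lifting) sum.cong)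
        also have "\<dots> = 0" using k by (intro c bij_betwE[OF u, rule_format]) simp
        finally show "lincomb a (v ` I) $ k = 0\<^sub>v n $ k" using k by simp
      next
        show "dim_vec (lincomb a (v ` I)) = dim_vec (0\<^sub>v n :: 'a vec)"
          using lincomb_closed[of "v ` I" a] carr[of I] by simp
      qed
      then have "\<not> lin_indpt (v ` I)" if "a (v i) \<noteq> 0"
        using i fin that unfolding lin_dep_def not_not
        by (intro exI[of _ "v ` I"] exI[of _ a] exI[of _ "v i"])
          auto
      then show "c i = 0" using R av[OF i] by auto
    qed
  qed
qed

text \<open>
  An independent set of columns has at most \<open>card J\<close> elements, because the coefficient vectors \<open>H y\<close>
  of more than \<open>card J\<close> columns are dependent.
\<close>

lemma rank_eq_card_basis:
  fixes f :: "'i \<Rightarrow> 'j \<Rightarrow> 'a"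
  assumes C: "C \<in> carrier_mat n nc" and u: "bij_betw u {0..<n} X"
    and cols: "set (cols C) = (\<lambda>y. vec n (\<lambda>k. f y (u k))) ` Y"
    and fin: "finite Y" and JY: "J \<subseteq> Y" and ind: "indep_family J X f"
    and span: "\<And>y x. y \<in> Y \<Longrightarrow> x \<in> X \<Longrightarrow> f y x = (\<Sum>j\<in>J. H y j * f j x)"
  shows "rank C = card J"
proof -
  define v where "v = (\<lambda>y. vec n (\<lambda>k. f y (u k)))"
  have finJ: "finite J" using JY fin by (rule finite_subset)
  have J: "inj_on v J" "lin_indpt (v ` J)"
    using indep_family_iff_lin_indpt[OF u finJ, of f] ind by (auto simp: v_def)
  have "card J = card (v ` J)" using J(1) by (simp add: card_image)
  also have "\<dots> \<le> rank C"
    by (rule rank_ge_card_indpt[OF C _ J(2)]) (use JY cols in \<open>auto simp: v_def\<close>)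
  finally have le: "card J \<le> rank C" .
  have "lin_indpt {}"
    using subset_li_is_li[OF J(2), of "{}"] by simp
  then obtain S where S: "maximal S (\<lambda>T. T \<subseteq> set (cols C) \<and> lin_indpt T)"
    using maximal_exists_superset[of "set (cols C)" "\<lambda>T. T \<subseteq> set (cols C) \<and> lin_indpt T" "{}"] by auto
  then have "S \<subseteq> v ` Y" "lin_indpt S" using cols by (auto simp: maximal_def v_def)
  then obtain I where I: "I \<subseteq> Y" "inj_on v I" "S = v ` I" by (auto simp: subset_image_inj)
  have finI: "finite I" using I(1) fin by (rule finite_subset)
  have indI: "indep_family I X f"
    using indep_family_iff_lin_indpt[OF u finI, of f] I \<open>lin_indpt S\<close> by (auto simp: v_def)
  have "\<not> card J < card I"
  proof
    assume "card J < card I"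
    then have "\<not> indep_family I J H" by (rule not_indep_family_if_card_less[OF finI finJ])
    then obtain c i where c: "\<And>j. j \<in> J \<Longrightarrow> (\<Sum>i\<in>I. c i * H i j) = 0" and i: "i \<in> I" "c i \<noteq> 0"
      by (rule not_indep_familyE) auto
    have "(\<Sum>i\<in>I. c i * f i x) = 0" if x: "x \<in> X" for x
    proof -
      have "(\<Sum>i\<in>I. c i * f i x) = (\<Sum>i\<in>I. \<Sum>j\<in>J. c i * H i j * f j x)"
        by (rule sum.cong) (use span[OF _ x] I(1) in \<open>auto simp: sum_distrib_left mult.assoc\<close>)
      also have "\<dots> = (\<Sum>j\<in>J. (\<Sum>i\<in>I. c i * H i j) * f j x)"
        by (subst sum.swap) (simp add: sum_distrib_right)
      also have "\<dots> = 0" using c by simp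
      finally show ?thesis .
    qed
    from indep_familyD[OF indI this i(1)] i(2) show False by simp
  qed
  moreover have "rank C = card I"
    using rank_card_indpt[OF C S] I(2,3) by (simp add: card_image)
  ultimately show ?thesis using le by simp
qed

end

section \<open>Coefficients of the pencil polynomial\<close>

text \<open>
  The matrix \<open>x I - A - t B\<close> is the diagonal matrix with entries \<open>x - \<alpha> i\<close> plus \<open>- t B\<close>. Its determinant
  expands over the set \<open>S\<close> on which the diagonal part is used, and the product of the \<open>x - \<alpha> i\<close> over
  \<open>S\<close> expands over the set \<open>T\<close> on which \<open>- \<alpha> i\<close> is used. The two families of signs combine to
  \<open>(-1) ^ (card T + card ({0..<n} - S))\<close>, and the exponent is \<open>n - g2\<close> in every summand that contributes.
\<close>

lemma pencil_coeff_expansion: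
  assumes B: "B \<in> carrier_mat n n" and f: "\<And>i j. i < n \<Longrightarrow> j < n \<Longrightarrow> B $$ (i, j) = f i j"
  shows "pencil_coeff (mat_diag n \<alpha>) B (g1, g2) = (- 1) ^ (n - g2) *
    (\<Sum>S\<in>Pow {0..<n}. \<Sum>T\<in>Pow S.
      if card (S - T) = g2 \<and> card ({0..<n} - S) = g1 then (\<Prod>i\<in>T. \<alpha> i) * idet ({0..<n} - S) f else 0)"
proof -
  let ?N = "{0..<n}"
  interpret c1: comm_ring_hom "\<lambda>c::real. [:c:]" by unfold_locales auto
  interpret c2: comm_ring_hom "\<lambda>c::real. [:[:c:]:]" by unfold_locales auto
  interpret c3: comm_ring_hom "\<lambda>c::real poly. [:c:]" by unfold_locales auto
  define t where "t = (- [:0, 1:] :: real poly)"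
  define x where "x = ([:0, 1:] :: real poly poly)"
  have x: "x ^ k = monom 1 k" for k by (simp add: x_def monom_altdef)
  have t: "t ^ k = monom ((- 1) ^ k) k" for k
  proof -
    have "[:0, 1:] = (monom 1 1 :: real poly)" by (simp add: monom_altdef)
    then have "t = monom (- 1) 1" by (simp add: t_def minus_monom)
    then show ?thesis by (simp add: monom_power)
  qed
  have "pencil_poly (mat_diag n \<alpha>) B = det (mat n n (\<lambda>(i, j).
    (if i = j then [:[:- \<alpha> i:]:] + x else 0) + [:t:] * [:[:f i j:]:]))"
    unfolding pencil_poly_def char_poly_def char_poly_matrix_def
    by (intro arg_cong[of _ _ det] eq_matI) (use B f in \<open>auto simp: mat_diag_def t_def x_def\<close>)
  also have "\<dots> = idet ?N (\<lambda>i j. (if i = j then [:[:- \<alpha> i:]:] + x else 0) + [:t:] * [:[:f i j:]:])"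
    by (subst idet_eq_det[of "\<lambda>i. i" n]) (auto simp: bij_betw_def)
  also have "\<dots> = (\<Sum>S\<in>Pow ?N. \<Sum>T\<in>Pow S. monom (monom ((\<Prod>i\<in>T. - \<alpha> i) *
      ((- 1) ^ card (?N - S) * idet (?N - S) f)) (card (?N - S))) (card (S - T)))"
    unfolding idet_add_diagonal[OF finite_atLeastLessThan]
  proof (rule sum.cong[OF refl])
    fix S assume "S \<in> Pow ?N"
    then have finS: "finite S" by (auto intro: finite_subset)
    have "idet (?N - S) (\<lambda>i j. [:t:] * [:[:f i j:]:]) = [:t:] ^ card (?N - S) * [:[:idet (?N - S) f:]:]"
      by (simp only: idet_scale[OF finite_Diff[OF finite_atLeastLessThan]] c2.hom_idet)
    also have "\<dots> = [:monom ((- 1) ^ card (?N - S) * idet (?N - S) f) (card (?N - S)):]"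
      unfolding c3.hom_power[symmetric] c3.hom_mult[symmetric] t by (simp add: smult_monom mult.commute)
    finally have minor: "idet (?N - S) (\<lambda>i j. [:t:] * [:[:f i j:]:]) =
      [:monom ((- 1) ^ card (?N - S) * idet (?N - S) f) (card (?N - S)):]" .
    have "(\<Prod>i\<in>S. [:[:- \<alpha> i:]:] + x) * idet (?N - S) (\<lambda>i j. [:t:] * [:[:f i j:]:]) =
      (\<Sum>T\<in>Pow S. [:[:\<Prod>i\<in>T. - \<alpha> i:]:] * monom 1 (card (S - T)) *
        [:monom ((- 1) ^ card (?N - S) * idet (?N - S) f) (card (?N - S)):])"
      unfolding minor prod_add[OF finS] sum_distrib_right by (simp only: c2.hom_prod x prod_constant)
    also have "\<dots> = (\<Sum>T\<in>Pow S. monom (monom ((\<Prod>i\<in>T. - \<alpha> i) *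
      ((- 1) ^ card (?N - S) * idet (?N - S) f)) (card (?N - S))) (card (S - T)))"
      by (rule sum.cong) (auto simp: smult_monom mult.commute)
    finally show "(\<Prod>i\<in>S. [:[:- \<alpha> i:]:] + x) * idet (?N - S) (\<lambda>i j. [:t:] * [:[:f i j:]:]) =
      (\<Sum>T\<in>Pow S. monom (monom ((\<Prod>i\<in>T. - \<alpha> i) *
      ((- 1) ^ card (?N - S) * idet (?N - S) f)) (card (?N - S))) (card (S - T)))" .
  qed
  finally have "pencil_coeff (mat_diag n \<alpha>) B (g1, g2) = (\<Sum>S\<in>Pow ?N. \<Sum>T\<in>Pow S.
      if card (S - T) = g2 \<and> card (?N - S) = g1
      then (\<Prod>i\<in>T. - \<alpha> i) * ((- 1) ^ card (?N - S) * idet (?N - S) f) else 0)"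
    unfolding pencil_coeff_def by (auto simp: coeff_sum intro!: sum.cong)
  also have "\<dots> = (- 1) ^ (n - g2) * (\<Sum>S\<in>Pow ?N. \<Sum>T\<in>Pow S.
      if card (S - T) = g2 \<and> card (?N - S) = g1 then (\<Prod>i\<in>T. \<alpha> i) * idet (?N - S) f else 0)"
    unfolding sum_distrib_left
  proof (intro sum.cong[OF refl])
    fix S T assume "S \<in> Pow ?N" and "T \<in> Pow S"
    then have ST: "S \<subseteq> ?N" "T \<subseteq> S" "finite S" "finite T"
      by (auto intro: finite_subset[of _ ?N])
    have "card T + card (S - T) = card S" "card S + card (?N - S) = n"
      using ST card_mono[of S T] card_mono[of ?N S] by (simp_all add: card_Diff_subset)
    then have "n - card (S - T) = card T + card (?N - S)" by simp
    moreover have "(\<Prod>i\<in>T. - \<alpha> i) = (- 1) ^ card T * (\<Prod>i\<in>T. \<alpha> i)"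
      using prod.distrib[of "\<lambda>i. - 1" \<alpha> T] by simp
    ultimately show "(if card (S - T) = g2 \<and> card (?N - S) = g1
      then (\<Prod>i\<in>T. - \<alpha> i) * ((- 1) ^ card (?N - S) * idet (?N - S) f) else 0) =
      (- 1) ^ (n - g2) * (if card (S - T) = g2 \<and> card (?N - S) = g1
      then (\<Prod>i\<in>T. \<alpha> i) * idet (?N - S) f else 0)"
      by (auto simp: power_add)
  qed
  finally show ?thesis .
qed

section \<open>Sums of minors of a partitioned symmetric matrix\<close>

text \<open>
  A symmetric matrix with a distinguished set \<open>Lo\<close> of rows. The columns \<open>R\<close> form a basis of the columns of
  the block on \<open>Lo\<close>, and \<open>J\<close> extends \<open>R\<close> to a basis of all columns, restricted to the rows \<open>Lo\<close>;
  \<open>G\<close> and \<open>H\<close> are the coordinates with respect to these bases. Since \<open>f\<close> is symmetric, \<open>f y x\<close> with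
  \<open>x\<close> in \<open>Lo\<close> is an entry of the column \<open>y\<close> of the lower rows. In the application \<open>card R\<close> and \<open>card J\<close>
  are the ranks of \<open>B22\<close> and \<open>(B21 B22)\<close>.
\<close>

locale partitioned_symmetric =
  fixes f :: "nat \<Rightarrow> nat \<Rightarrow> real" and Up Lo R J :: "nat set" and G H :: "nat \<Rightarrow> nat \<Rightarrow> real"
  assumes finite_Up: "finite Up" and finite_Lo: "finite Lo" and disjoint: "Up \<inter> Lo = {}"
    and sym: "f x y = f y x"
    and R_Lo: "R \<subseteq> Lo" and R_J: "R \<subseteq> J" and J_sub: "J \<subseteq> Up \<union> Lo"
    and indep_J: "indep_family J Lo f"
    and span_R: "y \<in> Lo \<Longrightarrow> x \<in> Lo \<Longrightarrow> f y x = (\<Sum>k\<in>R. G y k * f k x)"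
    and span_J: "y \<in> Up \<union> Lo \<Longrightarrow> x \<in> Lo \<Longrightarrow> f y x = (\<Sum>k\<in>J. H y k * f k x)"
begin

lemma finite_R: "finite R" and finite_J: "finite J"
  using finite_subset[OF R_Lo finite_Lo] finite_subset[OF J_sub] finite_Up finite_Lo by auto

lemma indep_R: "indep_family R Lo f"
  by (rule indep_family_subset[OF indep_J R_J finite_J])

text \<open>
  Symmetry makes the rows \<open>R\<close> span the rows of the block on \<open>Lo\<close> as well, so a relation between the
  columns \<open>R\<close> that holds in the rows \<open>R\<close> holds in all rows \<open>Lo\<close>.
\<close>

lemma idet_R_nonzero: "idet R f \<noteq> 0"
proof -
  have "indep_family R R f"
  proof (rule indep_familyI)
    fix c i assume c: "\<And>b. b \<in> R \<Longrightarrow> (\<Sum>a\<in>R. c a * f a b) = 0" and i: "i \<in> R"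
    show "c i = 0"
    proof (rule indep_familyD[OF indep_R _ i])
      fix x assume x: "x \<in> Lo"
      have "(\<Sum>a\<in>R. c a * f a x) = (\<Sum>a\<in>R. \<Sum>b\<in>R. G x b * (c a * f a b))"
      proof (rule sum.cong[OF refl])
        fix a assume "a \<in> R"
        then have "f a x = (\<Sum>b\<in>R. G x b * f a b)"
          using span_R[OF x, of a] R_Lo sym by (metis (no_types, lifting) subsetD sum.cong)
        then show "c a * f a x = (\<Sum>b\<in>R. G x b * (c a * f a b))"
          by (simp add: sum_distrib_left mult.left_commute)
      qed
      also have "\<dots> = (\<Sum>b\<in>R. G x b * (\<Sum>a\<in>R. c a * f a b))"
        by (subst sum.swap) (simp add: sum_distrib_left)
      also have "\<dots> = 0" using c by simp
      finally show "(\<Sum>a\<in>R. c a * f a x) = 0" .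
    qed
  qed
  then show ?thesis using idet_eq_0_iff[OF finite_R] by blast
qed

text \<open>
  A lower column outside \<open>R\<close> depends on the columns \<open>R\<close>, so it cannot belong to a basis containing \<open>R\<close>.
\<close>

lemma J_diff_R: "J - R \<subseteq> Up"
proof
  fix y assume y: "y \<in> J - R"
  show "y \<in> Up"
  proof (rule ccontr)
    assume "y \<notin> Up"
    then have yLo: "y \<in> Lo" using y J_sub by auto
    have "(\<Sum>k\<in>J. (if k = y then 1 else if k \<in> R then - G y k else 0) * f k x) = 0"
      if x: "x \<in> Lo" for x
    proof -
      have "(\<Sum>k\<in>J. (if k = y then 1 else if k \<in> R then - G y k else 0) * f k x) =
          (\<Sum>k\<in>insert y R. (if k = y then 1 else if k \<in> R then - G y k else 0) * f k x)"
        by (rule sum.mono_neutral_right) (use y R_J finite_J in auto)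
      also have "\<dots> = f y x + (\<Sum>k\<in>R. (if k = y then 1 else if k \<in> R then - G y k else 0) * f k x)"
        using y finite_R by simp
      also have "(\<Sum>k\<in>R. (if k = y then 1 else if k \<in> R then - G y k else 0) * f k x) =
          (\<Sum>k\<in>R. - (G y k * f k x))"
        by (rule sum.cong) (use y in auto)
      also have "f y x + \<dots> = 0" using span_R[OF yLo x] by (simp add: sum_negf)
      finally show ?thesis .
    qed
    from indep_familyD[OF indep_J this, of y] y show False by simp
  qed
qed

lemma idet_eq_0_if_many_lower_rows:
  assumes U: "U \<subseteq> Up \<union> Lo" and "card J < card (U \<inter> Lo)"
  shows "idet U f = 0"
proof (rule idet_eq_0_if_rows_factor[where g = f and Z = J])
  show "finite U" using U finite_Up finite_Lo finite_subset by blast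
  show "\<exists>h. \<forall>x\<in>U \<inter> Lo. f x j = (\<Sum>k\<in>J. h k * f k x)" if "j \<in> U" for j
    using span_J[of j] U that sym[of _ j] by (intro exI[of _ "H j"]) auto
qed (use assms finite_J in auto)

text \<open>
  Restricted to the columns in \<open>U\<close>, the lower rows are determined by their entries in the upper columns of
  \<open>U\<close> and in the columns \<open>R\<close>.
\<close>

lemma idet_eq_0_if_few_upper_rows:
  assumes U: "U \<subseteq> Up \<union> Lo" and less: "card (U \<inter> Up) + card R < card (U \<inter> Lo)"
  shows "idet U f = 0"
proof (rule idet_eq_0_if_rows_factor[where g = f and Z = "(U \<inter> Up) \<union> R"])
  show "finite U" using U finite_Up finite_Lo finite_subset by blast
  show finZ: "finite (U \<inter> Up \<union> R)" using finite_Up finite_R by simp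
  show "card (U \<inter> Up \<union> R) < card (U \<inter> Lo)" using less card_Un_le[of "U \<inter> Up" R] by linarith
  show "\<exists>h. \<forall>x\<in>U \<inter> Lo. f x j = (\<Sum>k\<in>U \<inter> Up \<union> R. h k * f k x)" if j: "j \<in> U" for j
  proof (cases "j \<in> Up")
    case True
    then have "f x j = (\<Sum>k\<in>U \<inter> Up \<union> R. (if k = j then 1 else 0) * f k x)" for x
      using j finZ sym[of x j] by (simp add: if_distrib[of "\<lambda>z. z * _"] cong: if_cong)
    then show ?thesis by (intro exI[of _ "\<lambda>k. if k = j then 1 else 0"]) blast
  next
    case False
    then have jLo: "j \<in> Lo" using U j by auto
    have "f x j = (\<Sum>k\<in>U \<inter> Up \<union> R. (if k \<in> R then G j k else 0) * f k x)" if x: "x \<in> U \<inter> Lo" for x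
    proof -
      have "(\<Sum>k\<in>U \<inter> Up \<union> R. (if k \<in> R then G j k else 0) * f k x) = (\<Sum>k\<in>R. G j k * f k x)"
        by (rule sum.mono_neutral_cong_right) (use finZ in auto)
      then show ?thesis using span_R[OF jLo, of x] x sym[of x j] by simp
    qed
    then show ?thesis by (intro exI[of _ "\<lambda>k. if k \<in> R then G j k else 0"]) blast
  qed
qed auto

lemma idet_balanced:
  assumes K: "K \<subseteq> Up" and L: "L \<subseteq> Lo" and card: "card L = card K + card R"
  obtains \<delta> where "idet R f * idet (K \<union> L) f = (- 1) ^ card K * \<delta>\<^sup>2"
    and "indep_family (K \<union> R) L f \<longleftrightarrow> \<delta> \<noteq> 0"
proof -
  have fin: "finite K" "finite L" using K L finite_Up finite_Lo finite_subset by blast+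
  have disj: "K \<inter> L = {}" "K \<inter> R = {}" using K L R_Lo disjoint by blast+
  have factor: "f x y = (\<Sum>a\<in>R. G x a * f a y)" if "x \<in> L" "y \<in> L \<union> R" for x y
    using that L R_Lo by (intro span_R) blast+
  show thesis
    by (rule idet_bordered_low_rank[OF fin finite_R disj card sym]) (fact factor, rule that)
qed

text \<open>
  The right-hand side of \<open>pencil_coeff_expansion\<close> without its sign.
\<close>

definition minor_sum :: "(nat \<Rightarrow> real) \<Rightarrow> nat \<Rightarrow> nat \<Rightarrow> real" where
  "minor_sum \<alpha> g1 g2 = (\<Sum>S\<in>Pow (Up \<union> Lo). \<Sum>T\<in>Pow S.
     if card (S - T) = g2 \<and> card (Up \<union> Lo - S) = g1 then (\<Prod>i\<in>T. \<alpha> i) * idet (Up \<union> Lo - S) f else 0)"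

context
  fixes \<alpha> :: "nat \<Rightarrow> real"
  assumes pos: "i \<in> Up \<Longrightarrow> 0 < \<alpha> i" and zero: "i \<in> Lo \<Longrightarrow> \<alpha> i = 0"
begin

lemma prod_weight_eq_0:
  assumes "T \<subseteq> Up \<union> Lo" and "\<not> T \<subseteq> Up"
  shows "(\<Prod>i\<in>T. \<alpha> i) = 0"
proof (rule prod_zero)
  show "finite T" using assms(1) finite_Up finite_Lo finite_subset by blast
  show "\<exists>i\<in>T. \<alpha> i = 0" using assms zero by auto
qed

lemma prod_weight_pos: "T \<subseteq> Up \<Longrightarrow> 0 < (\<Prod>i\<in>T. \<alpha> i)"
  using pos by (intro prod_pos) auto

text \<open>
  The set \<open>T\<close> has \<open>card Up - k - l\<close> elements, and the upper indices outside \<open>S\<close> avoid it.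
\<close>

lemma upper_lower_cards:
  assumes S: "S \<subseteq> Up \<union> Lo" and T: "T \<subseteq> S" "T \<subseteq> Up"
    and card: "card (S - T) = card Lo - card R - k" "card (Up \<union> Lo - S) = card R + 2 * k + l"
    and k: "card R + k \<le> card Lo" "k + l \<le> card Up"
  shows "card ((Up \<union> Lo - S) \<inter> Up) \<le> k + l"
    and "card ((Up \<union> Lo - S) \<inter> Up) + card ((Up \<union> Lo - S) \<inter> Lo) = card R + 2 * k + l"
proof -
  let ?U = "Up \<union> Lo - S"
  have fin: "finite S" "finite T" using S T finite_Up finite_Lo finite_subset by blast+
  have "card T + card (S - T) = card S"
    using card_mono[OF fin(1) T(1)] card_Diff_subset[OF fin(2) T(1)] by simp
  moreover have "card S + card ?U = card Up + card Lo"
    using card_mono[OF _ S] card_Diff_subset[OF fin(1) S] finite_Up finite_Lo disjoint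
    by (simp add: card_Un_disjoint)
  ultimately have "card T + k + l = card Up" using card k by simp
  moreover have "card T + card (?U \<inter> Up) = card (T \<union> (?U \<inter> Up))"
    by (rule card_Un_disjoint[symmetric]) (use fin finite_Up T(1) in auto)
  moreover have "card (T \<union> (?U \<inter> Up)) \<le> card Up"
    by (rule card_mono) (use finite_Up T(2) in auto)
  ultimately show "card (?U \<inter> Up) \<le> k + l" by simp
  have "card (?U \<inter> Up) + card (?U \<inter> Lo) = card ((?U \<inter> Up) \<union> (?U \<inter> Lo))"
    by (rule card_Un_disjoint[symmetric]) (use finite_Up finite_Lo disjoint in auto)
  also have "(?U \<inter> Up) \<union> (?U \<inter> Lo) = ?U" by auto
  finally show "card (?U \<inter> Up) + card (?U \<inter> Lo) = card R + 2 * k + l" using card by simp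
qed

lemma minor_sum_eq_0:
  assumes "card J < card R + k" and k: "card R + k \<le> card Lo" "k + l \<le> card Up"
  shows "minor_sum \<alpha> (card R + 2 * k + l) (card Lo - card R - k) = 0"
  unfolding minor_sum_def
proof (intro sum.neutral ballI, goal_cases)
  case (1 S T)
  let ?U = "Up \<union> Lo - S"
  have S: "S \<subseteq> Up \<union> Lo" and T: "T \<subseteq> S" using 1 by auto
  have "(\<Prod>i\<in>T. \<alpha> i) = 0 \<or> idet ?U f = 0"
    if card: "card (S - T) = card Lo - card R - k" "card ?U = card R + 2 * k + l"
  proof (cases "T \<subseteq> Up")
    case False
    then show ?thesis using prod_weight_eq_0 S T by blast
  next
    case True
    have "card J < card (?U \<inter> Lo)"
      using upper_lower_cards[OF S T True card k] assms(1) by simp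
    then show ?thesis using idet_eq_0_if_many_lower_rows[of ?U] by simp
  qed
  then show ?case by auto
qed

text \<open>
  After multiplication by \<open>(-1) ^ k * idet R f\<close> every summand is nonnegative: it is zero, or a positive
  weight times a square. A positive one exists because \<open>R\<close> can be enlarged inside the basis \<open>J\<close> by \<open>k\<close>
  further columns, which remain independent on as many suitable rows \<open>L\<close>.
\<close>

lemma minor_sum_nonzero:
  assumes "card R + k \<le> card J" and k: "card R + k \<le> card Lo" "k \<le> card Up"
  shows "minor_sum \<alpha> (card R + 2 * k) (card Lo - card R - k) \<noteq> 0"
proof -
  let ?N = "Up \<union> Lo"
  define \<sigma> where "\<sigma> = (- 1) ^ k * idet R f"
  define summand where "summand S T = (if card (S - T) = card Lo - card R - k \<and>
    card (?N - S) = card R + 2 * k then (\<Prod>i\<in>T. \<alpha> i) * idet (?N - S) f else 0)" for S T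
  have balanced: "\<exists>\<delta>. \<sigma> * idet (K \<union> L) f = \<delta>\<^sup>2 \<and> (indep_family (K \<union> R) L f \<longleftrightarrow> \<delta> \<noteq> 0)"
    if KL: "K \<subseteq> Up" "L \<subseteq> Lo" "card L = card K + card R" and k: "card K = k" for K L
  proof -
    obtain \<delta> where "idet R f * idet (K \<union> L) f = (- 1) ^ card K * \<delta>\<^sup>2"
      and d: "indep_family (K \<union> R) L f \<longleftrightarrow> \<delta> \<noteq> 0"
      by (rule idet_balanced[OF KL])
    then have "\<sigma> * idet (K \<union> L) f = (- 1) ^ k * ((- 1) ^ k * \<delta>\<^sup>2)"
      using k by (simp add: \<sigma>_def mult.assoc)
    also have "\<dots> = \<delta>\<^sup>2" by (simp add: mult.assoc[symmetric] power_add[symmetric])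
    finally show ?thesis using d by blast
  qed
  have nonneg: "0 \<le> \<sigma> * summand S T" if S: "S \<subseteq> ?N" and T: "T \<subseteq> S" for S T
  proof (cases "T \<subseteq> Up \<and> card (S - T) = card Lo - card R - k \<and> card (?N - S) = card R + 2 * k")
    case False
    then have "summand S T = 0"
      using prod_weight_eq_0[of T] S T by (cases "T \<subseteq> Up") (auto simp: summand_def)
    then show ?thesis by simp
  next
    case True
    define K L where "K = (?N - S) \<inter> Up" and "L = (?N - S) \<inter> Lo"
    have KL: "?N - S = K \<union> L" by (auto simp: K_def L_def)
    have cards: "card K \<le> k" "card K + card L = card R + 2 * k"
      using upper_lower_cards[of S T k 0] S T True k by (auto simp: K_def L_def)
    have "0 \<le> \<sigma> * idet (?N - S) f"
    proof (cases "card K = k")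
      case True
      then obtain \<delta> where "\<sigma> * idet (K \<union> L) f = \<delta>\<^sup>2"
        using balanced[of K L] cards by (auto simp: K_def L_def)
      then show ?thesis unfolding KL by simp
    next
      case False
      then have "card K + card R < card L" using cards by simp
      then have "idet (?N - S) f = 0"
        unfolding K_def L_def by (intro idet_eq_0_if_few_upper_rows) auto
      then show ?thesis by simp
    qed
    moreover have "0 < (\<Prod>i\<in>T. \<alpha> i)" using True prod_weight_pos by blast
    ultimately have "0 \<le> (\<Prod>i\<in>T. \<alpha> i) * (\<sigma> * idet (?N - S) f)" by simp
    then show ?thesis using True by (simp add: summand_def mult.left_commute)
  qed
  have "card (J - R) = card J - card R" using card_Diff_subset[OF finite_R R_J] .
  then have "k \<le> card (J - R)" using assms(1) by simp
  then obtain K where K: "K \<subseteq> J - R" "card K = k" using obtain_subset_with_card_n by metis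
  have KUp: "K \<subseteq> Up" using K(1) J_diff_R by blast
  have finK: "finite K" using KUp finite_Up by (rule finite_subset)
  have "indep_family (K \<union> R) Lo f"
    by (rule indep_family_subset[OF indep_J _ finite_J]) (use K R_J in auto)
  then obtain L where L: "L \<subseteq> Lo" "card L = card (K \<union> R)" "indep_family (K \<union> R) L f"
    by (rule indep_family_select_points[OF _ finite_UnI[OF finK finite_R] finite_Lo]) (rule that)
  have "card (K \<union> R) = k + card R"
    using K finK finite_R by (subst card_Un_disjoint) auto
  then have cardL: "card L = k + card R" using L(2) by simp
  have finL: "finite L" using L(1) finite_Lo by (rule finite_subset)
  obtain \<delta> where "\<sigma> * idet (K \<union> L) f = \<delta>\<^sup>2" "\<delta> \<noteq> 0"
    using balanced[OF KUp L(1)] cardL K(2) L(3) by auto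
  then have pos_minor: "0 < \<sigma> * idet (K \<union> L) f" by simp
  \<comment> \<open>The summand in which the minor on \<open>K \<union> L\<close> occurs with the weight of all remaining upper indices.\<close>
  define S T where "S = ?N - (K \<union> L)" and "T = Up - K"
  have ST: "S \<subseteq> ?N" "T \<subseteq> S" using L(1) disjoint by (auto simp: S_def T_def)
  have "S - T = Lo - L" using KUp L(1) disjoint by (auto simp: S_def T_def)
  then have "card (S - T) = card Lo - card R - k"
    using cardL card_Diff_subset[OF finL L(1)] by simp
  moreover have U: "?N - S = K \<union> L" using KUp L(1) by (auto simp: S_def)
  moreover have "card (K \<union> L) = card R + 2 * k"
    using cardL K(2) finK finL KUp L(1) disjoint by (subst card_Un_disjoint) auto
  ultimately have "summand S T = (\<Prod>i\<in>T. \<alpha> i) * idet (K \<union> L) f" by (simp add: summand_def)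
  then have eq: "\<sigma> * summand S T = (\<Prod>i\<in>T. \<alpha> i) * (\<sigma> * idet (K \<union> L) f)"
    by (simp only: mult.left_commute)
  moreover have "0 < (\<Prod>i\<in>T. \<alpha> i)" by (rule prod_weight_pos) (simp add: T_def)
  ultimately have pos_summand: "0 < \<sigma> * summand S T" unfolding eq using pos_minor by simp
  have finN: "finite ?N" using finite_Up finite_Lo by simp
  have "0 < (\<Sum>T\<in>Pow S. \<sigma> * summand S T)"
  proof (rule sum_pos2)
    show "finite (Pow S)" using finite_subset[OF ST(1) finN] by simp
    show "T \<in> Pow S" using ST(2) by simp
  qed (use pos_summand nonneg[OF ST(1)] in auto)
  then have "0 < (\<Sum>S\<in>Pow ?N. \<Sum>T\<in>Pow S. \<sigma> * summand S T)"
    by (rule sum_pos2[rotated 2]) (use ST(1) finN nonneg in \<open>auto intro!: sum_nonneg\<close>)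
  also have "\<dots> = \<sigma> * minor_sum \<alpha> (card R + 2 * k) (card Lo - card R - k)"
    by (simp add: minor_sum_def summand_def sum_distrib_left)
  finally show ?thesis by auto
qed

end

end

section \<open>Vanishing coefficients and the rank of the lower rows\<close>

theorem theorem3p8:
  fixes m n r mu_t :: nat
    and a :: "nat \<Rightarrow> real"
    and A B B11 B21 B22 :: "real mat"
  assumes "0 < m" and "m < n"
    and "\<forall>k\<in>{1..n - m}. 0 < a k"
    and "A = mat_diag n (\<lambda>i. if i < n - m then a (i + 1) else 0)"
    and "B \<in> carrier_mat n n" and "transpose_mat B = B"
    and "B11 \<in> carrier_mat (n - m) (n - m)"
    and "B21 \<in> carrier_mat m (n - m)"
    and "B22 \<in> carrier_mat m m"
    and "B = four_block_mat B11 (transpose_mat B21) B21 B22"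
    and "r = mat_rank B22"
    and "mu_t \<in> {1..min (m - r) (n - m)}"
  shows "(pencil_coeff A B (r + 2 * mu_t, m - r - mu_t) = 0
            \<longleftrightarrow> mat_rank (append_cols B21 B22) < r + mu_t) \<and>
         (mat_rank (append_cols B21 B22) < r + mu_t \<longrightarrow>
            (\<forall>mu\<in>{mu_t..min (m - r) (n - m)}. \<forall>nu\<in>{0..n - m - mu}.
               pencil_coeff A B (r + 2 * mu + nu, m - r - mu) = 0))"
proof -
  define p where "p = n - m"
  have n: "n = p + m" using assms(2) by (simp add: p_def)
  let ?C = "append_cols B21 B22"
  define \<alpha> where "\<alpha> = (\<lambda>i. if i < p then a (i + 1) else 0)"
  have A: "A = mat_diag n \<alpha>" using assms(4) by (simp add: \<alpha>_def p_def)
  \<comment> \<open>Extending the matrix by zero makes symmetry hold for all arguments.\<close>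
  define f where "f = (\<lambda>i j. if i < n \<and> j < n then B $$ (i, j) else 0)"
  have fB: "B $$ (i, j) = f i j" if "i < n" "j < n" for i j using that by (simp add: f_def)
  have sym: "f x y = f y x" for x y
  proof (cases "x < n \<and> y < n")
    case True
    then have "transpose_mat B $$ (x, y) = B $$ (y, x)" using assms(5) by simp
    then show ?thesis using assms(6) True by (simp add: f_def)
  qed (auto simp: f_def)
  have f21: "f j (p + i) = B21 $$ (i, j)" if "i < m" "j < p" for i j
    unfolding sym[of j] using that assms(7-9) n by (simp add: f_def assms(10) p_def[symmetric])
  have f22: "f (p + j) (p + i) = B22 $$ (i, j)" if "i < m" "j < m" for i j
    unfolding sym[of "p + j"] using that assms(7-9) n by (simp add: f_def assms(10) p_def[symmetric])
  have C: "?C \<in> carrier_mat m n"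
    using assms(8,9) n by (intro carrier_matI) (auto simp: append_cols_def p_def[symmetric])
  have fC: "f j (p + i) = ?C $$ (i, j)" if "i < m" "j < n" for i j
    using that assms(8,9) n f21[of i j] f22[of i "j - p"]
    by (auto simp: append_cols_def p_def[symmetric])
  let ?Up = "{0..<p}" and ?Lo = "{p..<n}"
  have N: "?Up \<union> ?Lo = {0..<n}" using n by auto
  have u: "bij_betw (\<lambda>k. p + k) {0..<m} ?Lo"
    by (rule bij_betw_byWitness[where f' = "\<lambda>k. k - p"]) (auto simp: n)
  have empty: "indep_family {} ?Lo f" by (simp add: indep_family_def)
  obtain R G where R: "R \<subseteq> ?Lo" "indep_family R ?Lo f"
    and G: "\<And>y x. y \<in> ?Lo \<Longrightarrow> x \<in> ?Lo \<Longrightarrow> f y x = (\<Sum>k\<in>R. G y k * f k x)"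
    by (rule indep_family_extend_to_basis[OF finite_atLeastLessThan empty_subsetI empty]) (rule that)
  have R_sub: "R \<subseteq> {0..<n}" using R(1) by auto
  obtain J H where J: "R \<subseteq> J" "J \<subseteq> {0..<n}" "indep_family J ?Lo f"
    and H: "\<And>y x. y \<in> {0..<n} \<Longrightarrow> x \<in> ?Lo \<Longrightarrow> f y x = (\<Sum>k\<in>J. H y k * f k x)"
    by (rule indep_family_extend_to_basis[OF finite_atLeastLessThan R_sub R(2)]) (rule that)
  have rank22: "mat_rank B22 = card R"
  proof -
    have "set (cols B22) = (\<lambda>y. vec m (\<lambda>k. f y (p + k))) ` ?Lo"
    proof -
      have "set (cols B22) = (\<lambda>j. col B22 j) ` {0..<m}"
        using assms(9) by (simp add: cols_def)
      also have "\<dots> = (\<lambda>j. vec m (\<lambda>k. f (p + j) (p + k))) ` {0..<m}"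
        by (rule image_cong) (use assms(9) f22 in \<open>auto simp: col_def\<close>)
      also have "\<dots> = (\<lambda>y. vec m (\<lambda>k. f y (p + k))) ` ((\<lambda>k. p + k) ` {0..<m})"
        by (simp only: image_image)
      finally show ?thesis using bij_betw_imp_surj_on[OF u] by simp
    qed
    then have "vec_space.rank m B22 = card R"
      by (rule vec_space.rank_eq_card_basis[OF assms(9) u _ finite_atLeastLessThan R(1,2) G])
    then show ?thesis using assms(9) by (simp add: mat_rank_def)
  qed
  have rankC: "mat_rank ?C = card J"
  proof -
    have "set (cols ?C) = (\<lambda>j. col ?C j) ` {0..<n}"
      using C by (simp add: cols_def)
    also have "\<dots> = (\<lambda>y. vec m (\<lambda>k. f y (p + k))) ` {0..<n}"
      by (rule image_cong) (use C fC in \<open>auto simp: col_def\<close>)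
    finally have "vec_space.rank m ?C = card J"
      by (rule vec_space.rank_eq_card_basis[OF C u _ finite_atLeastLessThan J(2,3) H])
    then show ?thesis using C by (simp add: mat_rank_def)
  qed
  interpret partitioned_symmetric f ?Up ?Lo R J G H
  proof
    show "f x y = f y x" for x y by (rule sym)
    show "f y x = (\<Sum>k\<in>R. G y k * f k x)" if "y \<in> ?Lo" "x \<in> ?Lo" for y x
      using that by (rule G)
    show "f y x = (\<Sum>k\<in>J. H y k * f k x)" if "y \<in> ?Up \<union> ?Lo" "x \<in> ?Lo" for y x
      using that unfolding N by (rule H)
  qed (use R(1) J N in simp_all)
  have pos: "0 < \<alpha> i" if "i \<in> ?Up" for i
    using that assms(3) by (simp add: \<alpha>_def p_def)
  have zero: "\<alpha> i = 0" if "i \<in> ?Lo" for i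
    using that by (simp add: \<alpha>_def)
  have r: "r = card R" using assms(11) rank22 by simp
  have coeff: "pencil_coeff A B (g1, g2) = (- 1) ^ (n - g2) * minor_sum \<alpha> g1 g2" for g1 g2
    unfolding A minor_sum_def N by (rule pencil_coeff_expansion[OF assms(5) fB])
  have cards: "card ?Lo = m" "card ?Up = p" using n by simp_all
  have vanish: "pencil_coeff A B (r + 2 * mu + nu, m - r - mu) = 0"
    if "mat_rank ?C < r + mu_t" "mu \<in> {mu_t..min (m - r) (n - m)}" "nu \<in> {0..n - m - mu}" for mu nu
  proof -
    have "card J < card R + mu" "card R + mu \<le> m" "mu + nu \<le> p"
      using that assms(12) rankC r by (auto simp: p_def)
    then show ?thesis
      using minor_sum_eq_0[where \<alpha> = \<alpha> and k = mu and l = nu, OF pos zero, unfolded cards]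
      by (simp add: coeff r)
  qed
  moreover have "pencil_coeff A B (r + 2 * mu_t, m - r - mu_t) \<noteq> 0"
    if "\<not> mat_rank ?C < r + mu_t"
  proof -
    have "card R + mu_t \<le> card J" "card R + mu_t \<le> m" "mu_t \<le> p"
      using that assms(12) rankC r by (auto simp: p_def)
    then show ?thesis
      using minor_sum_nonzero[where \<alpha> = \<alpha> and k = mu_t, OF pos zero, unfolded cards]
      by (simp add: coeff r)
  qed
  moreover have "pencil_coeff A B (r + 2 * mu_t, m - r - mu_t) = 0" if "mat_rank ?C < r + mu_t"
    using vanish[OF that, of mu_t 0] assms(12) by simp
  ultimately show ?thesis by blast
qed

end
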